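(* Let $(G,R)$ be an arithmetical graph. If $g_0=g_{\min}=g_{\max}$, then $(G,R)$ has the Riemann-Roch property. Moreover, the corresponding directed graph $\vec G_R$ has the natural Riemann-Roch property.
   Context: $\mathbb N$ denotes the positive integers. Arithmetical graph: $G$ is a connected undirected finite loopless multigraph with vertices $v_0,\dots,v_n$ and adjacency matrix $A$; $R=(r_0,\dots,r_n)^T\in\mathbb N^{n+1}$ satisfies $\gcd(r_0,\dots,r_n)=1$, and there are $\delta_0,\dots,\delta_n\in\mathbb N$ with $(\mathcal D-A)R=\vec 0$, where $\mathcal D=\mathrm{diag}(\delta_0,\dots,\delta_n)$. The Laplacian is $Q=\mathcal D-A$, and $\Lambda_{(G,R)}$ is the lattice spanned by the columns of $Q$. The integer $g_0$ is defined by $2g_0-2=\sum_{i=0}^nr_i(\delta_i-2)$. For $S\in\mathbb N^{n+1}$ put $\Lambda_S=\{D\in\mathbb Z^{n+1}:D\cdot S=0\}$ and $\deg_S(x)=x\cdot S$. For a sub-lattice $\Lambda\subseteq\Lambda_S$ of rank $n$: $D\sim D'$ means $D-D'\in\Lambda$; $|D|=\{E\in\mathbb Z^{n+1}:E\ge\vec0,E\sim D\}$; $r(D)=\min\{\deg_S(E):E\in\mathbb Z^{n+1},E\ge\vec0,|D-E|=\emptyset\}-1$; $\Sigma(\Lambda)=\{D\in\mathbb Z^{n+1}:D\not\ge p\ \forall p\in\Lambda\}$; $Ext(\Sigma(\Lambda))$ is the set of $\nu\in\Sigma(\Lambda)$ with $\deg_S(\nu)\ge\deg_S(p)$ for all $p\in\Sigma(\Lambda)$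 with $\sum_i|p_i-\nu_i|\le1$; $g_{\min}$ (resp. $g_{\max}$) is the minimum (resp. maximum) of $\deg_S(\nu)$ over $Ext(\Sigma(\Lambda))$, plus $1$. $\Lambda$ has the Riemann-Roch property if $g_{\min}=g_{\max}=:g$ and there is $K\in\mathbb Z^{n+1}$ (a canonical divisor) with $\deg_S(K)=2g-2$ and $r(D)-r(K-D)=\deg_S(D)-g+1$ for all $D\in\mathbb Z^{n+1}$. For $(G,R)$, the numbers $g_{\min},g_{\max}$ and the Riemann-Roch property refer to $\Lambda_{(G,R)}\subseteq\Lambda_R$ with $\deg_R$. The corresponding directed graph $\vec G_R$ is obtained from $G$ by replacing each undirected edge between $v_i$ and $v_j$ by $r_j$ edges directed from $v_i$ to $v_j$ and $r_i$ edges directed from $v_j$ to $v_i$. Its Laplacian is $\mathrm{diag}(\deg^+(v_0),\dots,\deg^+(v_n))-\vec A$, where $\deg^+(v)$ is the out-degree in $\vec G_R$ and $\vec A_{i,j}$ is the number of edges from $v_i$ to $v_j$. $\vec G_R$ has the natural Riemann-Roch property if the lattice spanned by the rows of its Laplacian (a sub-lattice of $\Lambda_{\vec1}$, $\vec 1$ the all-ones vector, with $\deg_{\vec1}$) has the Riemann-Roch property with canonical divisor $K$ given by $K(v_i)=\deg^+(v_i)-2$, $0\le i\le n$. *)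

theory Defs
  imports "HOL-Analysis.Analysis" "HOL-Library.Multiset"
begin

section \<open>Divisors and the Riemann-Roch property of a lattice\<close>

text \<open>
  The index set \<open>{0,\<dots>,n}\<close> is a finite type \<open>'v\<close> with \<open>n + 1\<close> elements, a divisor is an element
  of \<open>int ^ 'v\<close>, and \<open>\<le>\<close> on \<open>int ^ 'v\<close> is the componentwise order of the library.
  The parameter \<open>S\<close> is a vector with positive entries and \<open>L\<close> a sub-lattice of rank \<open>n\<close> of
  \<open>{D. deg_wrt S D = 0}\<close>; the definitions are total, but the minima and maxima (\<open>LEAST\<close>,
  \<open>GREATEST\<close>) are only guaranteed to exist under these conditions.
\<close>

definition deg_wrt :: "int ^ 'v \<Rightarrow> int ^ 'v \<Rightarrow> int" where
  "deg_wrt S x = (\<Sum>i\<in>UNIV. x $ i * S $ i)"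

definition lin_equiv :: "(int ^ 'v) set \<Rightarrow> int ^ 'v \<Rightarrow> int ^ 'v \<Rightarrow> bool" where
  "lin_equiv L D D' \<longleftrightarrow> D - D' \<in> L"

definition linear_system :: "(int ^ 'v::finite) set \<Rightarrow> int ^ 'v \<Rightarrow> (int ^ 'v) set" where
  "linear_system L D = {E. E \<ge> 0 \<and> lin_equiv L E D}"

definition div_rank :: "int ^ 'v::finite \<Rightarrow> (int ^ 'v) set \<Rightarrow> int ^ 'v \<Rightarrow> int" where
  "div_rank S L D =
     (LEAST d. d \<in> {deg_wrt S E | E. E \<ge> 0 \<and> linear_system L (D - E) = {}}) - 1"

definition sigma_region :: "(int ^ 'v::finite) set \<Rightarrow> (int ^ 'v) set" where
  "sigma_region L = {D. \<forall>p\<in>L. \<not> D \<ge> p}"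

definition ext_points :: "int ^ 'v::finite \<Rightarrow> (int ^ 'v) set \<Rightarrow> (int ^ 'v) set" where
  "ext_points S L = {\<nu> \<in> sigma_region L.
     \<forall>p\<in>sigma_region L. (\<Sum>i\<in>UNIV. \<bar>p $ i - \<nu> $ i\<bar>) \<le> 1 \<longrightarrow> deg_wrt S \<nu> \<ge> deg_wrt S p}"

definition g_min :: "int ^ 'v::finite \<Rightarrow> (int ^ 'v) set \<Rightarrow> int" where
  "g_min S L = (LEAST d. d \<in> deg_wrt S ` ext_points S L) + 1"

definition g_max :: "int ^ 'v::finite \<Rightarrow> (int ^ 'v) set \<Rightarrow> int" where
  "g_max S L = (GREATEST d. d \<in> deg_wrt S ` ext_points S L) + 1"

definition riemann_roch_with :: "int ^ 'v::finite \<Rightarrow> (int ^ 'v) set \<Rightarrow> int ^ 'v \<Rightarrow> bool" where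
  "riemann_roch_with S L K \<longleftrightarrow>
     g_min S L = g_max S L \<and>
     deg_wrt S K = 2 * g_max S L - 2 \<and>
     (\<forall>D. div_rank S L D - div_rank S L (K - D) = deg_wrt S D - g_max S L + 1)"

definition riemann_roch_property :: "int ^ 'v::finite \<Rightarrow> (int ^ 'v) set \<Rightarrow> bool" where
  "riemann_roch_property S L \<longleftrightarrow> (\<exists>K. riemann_roch_with S L K)"

definition lattice_spanned :: "('k::finite \<Rightarrow> int ^ 'v) \<Rightarrow> (int ^ 'v) set" where
  "lattice_spanned b = range (\<lambda>c :: 'k \<Rightarrow> int. \<Sum>k\<in>UNIV. c k *s b k)"

definition diag_matrix :: "int ^ 'v \<Rightarrow> int ^ 'v ^ 'v" where
  "diag_matrix d = (\<chi> i j. if i = j then d $ i else 0)"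

section \<open>Arithmetical graphs\<close>

text \<open>
  A finite undirected loopless multigraph on the vertex set \<open>'v\<close> is the multiset of its edges, each
  edge being a two-element set of vertices. Since \<open>{i, i}\<close> is then never an edge, the diagonal of
  the adjacency matrix vanishes.
\<close>

type_synonym 'v multigraph = "'v set multiset"

definition loopless_multigraph :: "'v multigraph \<Rightarrow> bool" where
  "loopless_multigraph G \<longleftrightarrow> (\<forall>e\<in>#G. card e = 2)"

definition connected_multigraph :: "'v multigraph \<Rightarrow> bool" where
  "connected_multigraph G \<longleftrightarrow> (\<forall>u v. (u, v) \<in> {(x, y). {x, y} \<in># G}\<^sup>*)"

definition adj_matrix :: "'v multigraph \<Rightarrow> int ^ 'v ^ 'v" where
  "adj_matrix G = (\<chi> i j. int (count G {i, j}))"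

definition laplacian :: "'v multigraph \<Rightarrow> int ^ 'v \<Rightarrow> int ^ 'v ^ 'v" where
  "laplacian G \<delta> = diag_matrix \<delta> - adj_matrix G"

text \<open>
  The vector \<open>\<delta>\<close> is determined by \<open>G\<close> and \<open>R\<close>, because the entries of \<open>R\<close> are nonzero; it is an
  explicit parameter only to have a name for it.
\<close>

definition arithmetical_graph :: "'v::finite multigraph \<Rightarrow> int ^ 'v \<Rightarrow> int ^ 'v \<Rightarrow> bool" where
  "arithmetical_graph G R \<delta> \<longleftrightarrow>
     loopless_multigraph G \<and> connected_multigraph G \<and>
     (\<forall>i. R $ i > 0) \<and> (GCD i. R $ i) = 1 \<and>
     (\<forall>i. \<delta> $ i > 0) \<and> laplacian G \<delta> *v R = 0"

definition arith_lattice :: "'v::finite multigraph \<Rightarrow> int ^ 'v \<Rightarrow> (int ^ 'v) set" where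
  "arith_lattice G \<delta> = lattice_spanned (\<lambda>j. column j (laplacian G \<delta>))"

section \<open>The corresponding directed graph\<close>

text \<open>
  A directed multigraph is the multiset of its arcs (tail, head). For an edge \<open>e = {i, j}\<close> the inner
  sum below runs over the two orientations \<open>(i, j)\<close> and \<open>(j, i)\<close> of \<open>e\<close>; the former is taken
  \<open>R $ j\<close> times, the latter \<open>R $ i\<close> times.
\<close>

type_synonym 'v dimultigraph = "('v \<times> 'v) multiset"

definition directed_graph :: "'v::finite multigraph \<Rightarrow> int ^ 'v \<Rightarrow> 'v dimultigraph" where
  "directed_graph G R =
     (\<Sum>e\<in>#G. \<Sum>(i, j)\<in>{(i, j). {i, j} = e}. replicate_mset (nat (R $ j)) (i, j))"

definition out_deg :: "'v dimultigraph \<Rightarrow> 'v \<Rightarrow> int" where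
  "out_deg H v = int (size {#a \<in># H. fst a = v#})"

definition di_adj_matrix :: "'v dimultigraph \<Rightarrow> int ^ 'v ^ 'v" where
  "di_adj_matrix H = (\<chi> i j. int (count H (i, j)))"

definition di_laplacian :: "'v dimultigraph \<Rightarrow> int ^ 'v ^ 'v" where
  "di_laplacian H = diag_matrix (\<chi> i. out_deg H i) - di_adj_matrix H"

definition natural_riemann_roch :: "'v::finite dimultigraph \<Rightarrow> bool" where
  "natural_riemann_roch H \<longleftrightarrow>
     riemann_roch_with (vec 1) (lattice_spanned (\<lambda>i. row i (di_laplacian H)))
       (\<chi> i. out_deg H i - 2)"

end

theory Submission
  imports Defs
begin

text \<open>
  Maximal elements of \<open>\<Sigma>\<close> all having degree \<open>g - 1\<close> and \<open>\<nu> \<mapsto> K - \<nu>\<close> mapping them into \<open>\<Sigma>\<close>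
  suffice for Riemann-Roch. For an arithmetical graph, a divisor of \<open>\<Sigma>\<close> starts an infinite
  sequence of moves in which a vertex with a negative entry borrows. The sequence becomes
  periodic, and a quadratic invariant of a period shows that degrees in \<open>\<Sigma>\<close> are at most
  \<open>g\<^sub>0 - 1\<close>. In the case of equality the period can be reversed, which gives the reflection
  symmetry for \<open>K\<^sub>0 = \<delta> - 2\<close>. The directed lattice is the arithmetical one scaled
  componentwise by \<open>R\<close>, and \<open>\<nu> \<mapsto> R \<nu> + R - 1\<close> carries its maximal elements over.
\<close>

section \<open>Riemann-Roch from a reflection symmetry\<close>

lemma deg_wrt_add: "deg_wrt S (x + y) = deg_wrt S x + deg_wrt S y"
  by (simp add: deg_wrt_def sum.distrib algebra_simps)

lemma deg_wrt_diff: "deg_wrt S (x - y) = deg_wrt S x - deg_wrt S y"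
  by (simp add: deg_wrt_def sum_subtractf algebra_simps)

lemma deg_wrt_commute: "deg_wrt S x = deg_wrt x S"
  by (simp add: deg_wrt_def mult.commute)

lemma deg_wrt_add_left: "deg_wrt (S + T) x = deg_wrt S x + deg_wrt T x"
  by (simp add: deg_wrt_commute[of _ x] deg_wrt_add)

lemma deg_wrt_diff_left: "deg_wrt (S - T) x = deg_wrt S x - deg_wrt T x"
  by (simp add: deg_wrt_commute[of _ x] deg_wrt_diff)

lemma deg_wrt_axis:
  fixes S :: "int ^ 'v::finite"
  shows "deg_wrt S (axis i 1) = S $ i"
  by (simp add: deg_wrt_def axis_def if_distrib[of "\<lambda>x. x * _"] cong: if_cong)

lemma deg_wrt_mono:
  fixes S :: "int ^ 'v::finite"
  assumes "\<forall>i. S $ i > 0" "x \<le> y"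
  shows "deg_wrt S x \<le> deg_wrt S y"
  unfolding deg_wrt_def using assms
  by (intro sum_mono mult_right_mono) (auto simp: less_eq_vec_def less_imp_le)

lemma sigma_region_downward:
  assumes "D \<in> sigma_region L" "D' \<le> D"
  shows "D' \<in> sigma_region L"
  using assms order_trans unfolding sigma_region_def by blast

text \<open>An effective \<open>E\<close> equivalent to \<open>D\<close> is the same as a lattice
  point \<open>D - E\<close> below \<open>D\<close>. Closure under negation is what turns
  \<open>E - D\<close> into \<open>D - E\<close>.\<close>

lemma linear_system_empty_iff:
  assumes "\<And>p. p \<in> L \<Longrightarrow> - p \<in> L"
  shows "linear_system L D = {} \<longleftrightarrow> D \<in> sigma_region L"
proof
  assume *: "linear_system L D = {}"
  show "D \<in> sigma_region L"
    unfolding sigma_region_def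
  proof (intro CollectI ballI notI)
    fix p assume "p \<in> L" "p \<le> D"
    then have "D - p \<in> linear_system L D"
      using assms by (auto simp: linear_system_def lin_equiv_def less_eq_vec_def)
    with * show False by blast
  qed
next
  assume *: "D \<in> sigma_region L"
  have False if "E \<in> linear_system L D" for E
  proof -
    have "E \<ge> 0" "- (E - D) \<in> L"
      using that assms unfolding linear_system_def lin_equiv_def by blast+
    moreover from this have "- (E - D) \<le> D"
      by (auto simp: less_eq_vec_def)
    ultimately show False using * by (auto simp: sigma_region_def)
  qed
  then show "linear_system L D = {}" by blast
qed

text \<open>Something strictly above \<nu> in \<Sigma> would put a neighbour
  \<open>\<nu> + axis i 1\<close> of larger degree into \<Sigma>, as \<Sigma> is downward
  closed.\<close>

lemma ext_points_maximal:
  fixes S :: "int ^ 'v::finite"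
  assumes S: "\<forall>i. S $ i > 0" and "\<nu> \<in> ext_points S L" and "D \<in> sigma_region L" and "\<nu> \<le> D"
  shows "D = \<nu>"
proof (rule ccontr)
  assume "D \<noteq> \<nu>"
  then obtain i where i: "D $ i \<noteq> \<nu> $ i" by (auto simp: vec_eq_iff)
  have le: "\<nu> $ j \<le> D $ j" for j
    using assms(4) by (simp add: less_eq_vec_def)
  have lt: "\<nu> $ i < D $ i" using i le[of i] by linarith
  let ?p = "\<nu> + axis i 1"
  have "?p \<le> D"
    using le lt by (auto simp: less_eq_vec_def axis_def)
  then have "?p \<in> sigma_region L" using assms(3) sigma_region_downward by blast
  moreover have "(\<Sum>j\<in>UNIV. \<bar>?p $ j - \<nu> $ j\<bar>) \<le> 1"
    by (simp add: axis_def if_distrib[of abs] cong: if_cong)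
  ultimately have "deg_wrt S ?p \<le> deg_wrt S \<nu>"
    using assms(2) by (auto simp: ext_points_def)
  then show False using S[rule_format, of i] by (simp add: deg_wrt_add deg_wrt_axis)
qed

lemma ext_point_above:
  fixes S :: "int ^ 'v::finite"
  assumes S: "\<forall>i. S $ i > 0"
    and bound: "\<And>D. D \<in> sigma_region L \<Longrightarrow> deg_wrt S D \<le> B"
    and "D \<in> sigma_region L"
  obtains \<nu> where "\<nu> \<in> ext_points S L" "D \<le> \<nu>"
proof -
  let ?P = "\<lambda>x. x \<in> sigma_region L \<and> D \<le> x"
  have "?P D" using assms by simp
  \<comment> \<open>Among the elements of \<Sigma> above \<open>D\<close>, the least defect from
    \<open>B\<close> gives one of maximal degree.\<close>
  from ex_has_least_nat[of ?P, OF this, of "\<lambda>x. nat (B - deg_wrt S x)"]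
  obtain \<nu> where \<nu>: "\<nu> \<in> sigma_region L" "D \<le> \<nu>"
    and min: "\<And>y. y \<in> sigma_region L \<Longrightarrow> D \<le> y \<Longrightarrow> nat (B - deg_wrt S \<nu>) \<le> nat (B - deg_wrt S y)"
    by blast
  have "deg_wrt S p \<le> deg_wrt S \<nu>"
    if p: "p \<in> sigma_region L" "(\<Sum>i\<in>UNIV. \<bar>p $ i - \<nu> $ i\<bar>) \<le> 1" for p
  proof (cases "\<nu> \<le> p")
    case True
    then have "nat (B - deg_wrt S \<nu>) \<le> nat (B - deg_wrt S p)"
      using min p \<nu> order_trans by blast
    then show ?thesis using bound[OF p(1)] bound[OF \<nu>(1)] by linarith
  next
    case False
    then obtain i where i: "p $ i < \<nu> $ i" by (auto simp: less_eq_vec_def not_le)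
    have "p $ j \<le> \<nu> $ j" for j
    proof (cases "j = i")
      case False
      \<comment> \<open>Coordinate \<open>i\<close> already uses up the whole distance 1, so
        \<open>p\<close> agrees with \<nu> at \<open>j\<close>.\<close>
      have "\<bar>p $ i - \<nu> $ i\<bar> + \<bar>p $ j - \<nu> $ j\<bar> = (\<Sum>k\<in>{i, j}. \<bar>p $ k - \<nu> $ k\<bar>)"
        using False by simp
      also have "\<dots> \<le> (\<Sum>k\<in>UNIV. \<bar>p $ k - \<nu> $ k\<bar>)"
        by (rule sum_mono2) auto
      finally show ?thesis using i p(2) by linarith
    qed (use i in simp)
    then show ?thesis using S by (intro deg_wrt_mono) (simp_all add: less_eq_vec_def)
  qed
  then have "\<nu> \<in> ext_points S L" using \<nu> by (simp add: ext_points_def)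
  with \<nu> that show thesis by blast
qed

section \<open>The rank formula from a reflection symmetry\<close>

lemma Least_int_bounded_below:
  fixes P :: "int \<Rightarrow> bool"
  assumes "P d" and "\<And>d. P d \<Longrightarrow> B \<le> d"
  shows "P (Least P)" "\<And>d. P d \<Longrightarrow> Least P \<le> d"
proof -
  from ex_has_least_nat[of P, OF assms(1), of "\<lambda>x. nat (x - B)"]
  obtain m where m: "P m" "\<And>y. P y \<Longrightarrow> nat (m - B) \<le> nat (y - B)" by blast
  have le: "m \<le> y" if "P y" for y
    using m(2)[OF that] assms(2)[OF that] assms(2)[OF m(1)] by linarith
  have "Least P = m" using m le by (intro Least_equality) auto
  with m le show "P (Least P)" "\<And>d. P d \<Longrightarrow> Least P \<le> d" by auto
qed

text \<open>An optimal \<open>E\<close> for \<open>D\<close> places \<open>D - E\<close> below some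
  extreme \<nu>. The positive part of \<open>\<nu> - D\<close> then pushes \<open>K - D\<close>
  below \<open>K - \<nu>\<close>, hence into \<Sigma>, which bounds the rank of \<open>K - D\<close>
  by that of \<open>D\<close>.\<close>

theorem riemann_roch_if_reflection:
  fixes S :: "int ^ 'v::finite"
  assumes S: "\<forall>i. S $ i > 0"
    and neg: "\<And>p. p \<in> L \<Longrightarrow> - p \<in> L"
    and nonempty: "sigma_region L \<noteq> {}"
    and bound: "\<And>D. D \<in> sigma_region L \<Longrightarrow> deg_wrt S D \<le> B"
    and uniform: "\<And>\<nu>. \<nu> \<in> ext_points S L \<Longrightarrow> deg_wrt S \<nu> = g - 1"
    and reflect: "\<And>\<nu>. \<nu> \<in> ext_points S L \<Longrightarrow> K - \<nu> \<in> sigma_region L"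
    and K: "deg_wrt S K = 2 * g - 2"
  shows "riemann_roch_with S L K"
proof -
  obtain \<nu>\<^sub>0 where \<nu>\<^sub>0: "\<nu>\<^sub>0 \<in> ext_points S L"
    using nonempty ext_point_above[OF S bound] by blast
  have img: "deg_wrt S ` ext_points S L = {g - 1}"
    using uniform \<nu>\<^sub>0 by (force simp: image_iff)
  have gmin: "g_min S L = g"
    unfolding g_min_def img by (simp add: Least_equality)
  have gmax: "g_max S L = g"
    unfolding g_max_def img by (simp add: Greatest_equality)
  \<comment> \<open>\<open>A D\<close> holds for the degrees of effective divisors whose removal
    takes \<open>D\<close> into \<Sigma>; the rank is one less than their minimum.\<close>
  define A where "A D d \<longleftrightarrow> (\<exists>E. d = deg_wrt S E \<and> E \<ge> 0 \<and> D - E \<in> sigma_region L)" for D d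
  have "linear_system L D = {} \<longleftrightarrow> D \<in> sigma_region L" for D
    by (rule linear_system_empty_iff) (rule neg)
  then have rank: "div_rank S L D = Least (A D) - 1" for D
    by (simp add: div_rank_def A_def[abs_def])
  have A_nonneg: "0 \<le> d" if "A D d" for D d
  proof -
    obtain E where "d = deg_wrt S E" "0 \<le> E" using \<open>A D d\<close> A_def by blast
    with deg_wrt_mono[OF S this(2)] show ?thesis by (simp add: deg_wrt_def)
  qed
  have A_ex: "\<exists>d. A D d" for D
  proof -
    \<comment> \<open>Subtracting this positive part truncates \<open>D\<close> to the componentwise
      minimum with \<open>\<nu>\<^sub>0\<close>.\<close>
    let ?E = "\<chi> i. max 0 (D $ i - \<nu>\<^sub>0 $ i)"
    have "?E \<ge> 0" "D - ?E \<le> \<nu>\<^sub>0" by (auto simp: less_eq_vec_def)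
    moreover have "\<nu>\<^sub>0 \<in> sigma_region L" using \<nu>\<^sub>0 by (simp add: ext_points_def)
    ultimately show ?thesis unfolding A_def using sigma_region_downward by blast
  qed
  have A_Least: "A D (Least (A D))" "A D d \<Longrightarrow> Least (A D) \<le> d" for D d
  proof -
    obtain e where "A D e" using A_ex by blast
    then show "A D (Least (A D))"
      by (rule Least_int_bounded_below(1)) (rule A_nonneg)
    show "Least (A D) \<le> d" if "A D d"
      using that by (intro Least_int_bounded_below(2)[of "A D" d 0 d] A_nonneg)
  qed
  have step: "Least (A (K - D)) \<le> Least (A D) - deg_wrt S D + g - 1" for D
  proof -
    obtain E where E: "Least (A D) = deg_wrt S E" "E \<ge> 0" "D - E \<in> sigma_region L"
      using A_Least(1)[of D] unfolding A_def by blast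
    obtain \<nu> where \<nu>: "\<nu> \<in> ext_points S L" "D - E \<le> \<nu>"
      using ext_point_above[OF S bound E(3)] by blast
    let ?F = "\<chi> i. max 0 (\<nu> $ i - D $ i)"
    have "?F \<ge> 0" "K - D - ?F \<le> K - \<nu>" by (auto simp: less_eq_vec_def)
    then have "A (K - D) (deg_wrt S ?F)"
      unfolding A_def using reflect[OF \<nu>(1)] sigma_region_downward by blast
    then have "Least (A (K - D)) \<le> deg_wrt S ?F" by (rule A_Least(2))
    also have "?F \<le> \<nu> - D + E"
      unfolding less_eq_vec_def
    proof
      fix i
      have "0 \<le> E $ i" "D $ i - E $ i \<le> \<nu> $ i"
        using E(2) \<nu>(2) by (simp_all add: less_eq_vec_def)
      then show "?F $ i \<le> (\<nu> - D + E) $ i" by simp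
    qed
    then have "deg_wrt S ?F \<le> deg_wrt S (\<nu> - D + E)" by (rule deg_wrt_mono[OF S])
    also have "\<dots> = Least (A D) - deg_wrt S D + g - 1"
      using uniform[OF \<nu>(1)] E(1) by (simp add: deg_wrt_add deg_wrt_diff)
    finally show ?thesis .
  qed
  \<comment> \<open>Since \<open>K\<close> has degree \<open>2 * g - 2\<close>, the inequalities for
    \<open>D\<close> and for \<open>K - D\<close> are converse to each other.\<close>
  have "div_rank S L D - div_rank S L (K - D) = deg_wrt S D - g + 1" for D
    using step[of D] step[of "K - D"] K by (simp add: rank deg_wrt_diff)
  with gmin gmax K show ?thesis by (simp add: riemann_roch_with_def)
qed

section \<open>The lattice of an arithmetical graph\<close>

lemma finite_vec_interval:
  "finite {x :: int ^ 'v::finite. \<forall>i. lo i \<le> x $ i \<and> x $ i \<le> hi i}"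
proof -
  have "vec_nth ` {x :: int ^ 'v::finite. \<forall>i. lo i \<le> x $ i \<and> x $ i \<le> hi i} \<subseteq> (\<Pi>\<^sub>E i\<in>UNIV. {lo i..hi i})"
    by auto
  then have "finite (vec_nth ` {x :: int ^ 'v::finite. \<forall>i. lo i \<le> x $ i \<and> x $ i \<le> hi i})"
    by (rule finite_subset) (simp add: finite_PiE)
  then show ?thesis
    by (rule finite_imageD) (auto simp: inj_on_def vec_eq_iff)
qed

text \<open>Adding \<open>Q *v axis u 1\<close> to a divisor lets the vertex \<open>u\<close> borrow.\<close>

locale arith_graph =
  fixes G :: "'v::finite multigraph" and R \<delta> :: "int ^ 'v"
  assumes arith: "arithmetical_graph G R \<delta>"
begin

abbreviation "Q \<equiv> laplacian G \<delta>"
abbreviation "\<Lambda> \<equiv> arith_lattice G \<delta>"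
abbreviation "K\<^sub>0 \<equiv> \<delta> - 2"

lemma R_pos: "\<forall>i. R $ i > 0"
  using arith by (simp add: arithmetical_graph_def)

lemma laplacian_R: "Q *v R = 0"
  using arith by (simp add: arithmetical_graph_def)

lemma count_singleton: "count G {i} = 0"
proof (rule ccontr)
  assume "count G {i} \<noteq> 0"
  then have "{i} \<in># G" by (simp add: not_in_iff[symmetric])
  then have "card {i} = 2"
    using arith unfolding arithmetical_graph_def loopless_multigraph_def by blast
  then show False by simp
qed

lemma laplacian_component:
  "Q $ i $ j = (if i = j then \<delta> $ i else - int (count G {i, j}))"
  by (simp add: laplacian_def diag_matrix_def adj_matrix_def count_singleton)

lemma laplacian_symmetric: "Q $ i $ j = Q $ j $ i"
  by (simp add: laplacian_component insert_commute)

lemma laplacian_self_adjoint: "deg_wrt x (Q *v y) = deg_wrt y (Q *v x)"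
proof -
  have "deg_wrt x (Q *v y) = (\<Sum>i\<in>UNIV. \<Sum>j\<in>UNIV. Q $ i $ j * y $ j * x $ i)"
    by (simp add: deg_wrt_def matrix_vector_mult_def sum_distrib_right)
  also have "\<dots> = (\<Sum>j\<in>UNIV. \<Sum>i\<in>UNIV. Q $ j $ i * x $ i * y $ j)"
    by (subst sum.swap) (simp add: laplacian_symmetric mult_ac)
  also have "\<dots> = deg_wrt y (Q *v x)"
    by (simp add: deg_wrt_def matrix_vector_mult_def sum_distrib_right)
  finally show ?thesis .
qed

text \<open>Self-adjointness moves \<open>Q\<close> onto \<open>R\<close>, where it vanishes.
  Borrowing therefore preserves the degree.\<close>

lemma deg_laplacian: "deg_wrt R (Q *v f) = 0"
  by (subst laplacian_self_adjoint) (simp add: laplacian_R deg_wrt_def)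

lemma laplacian_axis: "(Q *v axis u 1) $ i = Q $ i $ u"
  by (simp add: matrix_vector_mult_def axis_def if_distrib[of "\<lambda>x. _ * x"] cong: if_cong)

lemma arith_lattice_eq: "\<Lambda> = range ((*v) Q)"
proof -
  have *: "(\<Sum>k\<in>UNIV. c k *s column k Q) = Q *v vec_lambda c" for c
    by (simp add: matrix_mult_sum)
  have "surj (vec_lambda :: ('v \<Rightarrow> int) \<Rightarrow> int ^ 'v)"
    by (rule surjI[of _ vec_nth]) (rule vec_nth_inverse)
  then show ?thesis
    unfolding arith_lattice_def lattice_spanned_def *
    by (metis image_image)
qed

section \<open>\<Sigma> as the divisors that no combination of moves makes effective\<close>

lemma sigma_iff: "D \<in> sigma_region \<Lambda> \<longleftrightarrow> (\<forall>f. \<not> 0 \<le> D + Q *v f)"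
proof -
  have eq: "Q *v f \<le> D \<longleftrightarrow> 0 \<le> D + Q *v (- f)" for f
    by (simp add: less_eq_vec_def matrix_vector_mult_def sum_negf)
  have "D \<in> sigma_region \<Lambda> \<longleftrightarrow> (\<forall>f. \<not> 0 \<le> D + Q *v (- f))"
    by (simp add: sigma_region_def arith_lattice_eq eq)
  also have "\<dots> \<longleftrightarrow> (\<forall>f. \<not> 0 \<le> D + Q *v f)" by (metis minus_minus)
  finally show ?thesis .
qed

lemma sigma_translate: "D + Q *v f \<in> sigma_region \<Lambda> \<longleftrightarrow> D \<in> sigma_region \<Lambda>"
proof -
  have *: "D + Q *v f \<in> sigma_region \<Lambda>" if "D \<in> sigma_region \<Lambda>" for D f
    unfolding sigma_iff
  proof
    fix h
    have "D + Q *v f + Q *v h = D + Q *v (f + h)"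
      by (simp add: matrix_vector_right_distrib)
    then show "\<not> 0 \<le> D + Q *v f + Q *v h" using that unfolding sigma_iff by metis
  qed
  have "D + Q *v f + Q *v (- f) = D"
    by (simp add: vec_eq_iff matrix_vector_mult_def sum_negf)
  with *[of D f] *[of "D + Q *v f" "- f"] show ?thesis by auto
qed

lemma sigma_if_deg_neg:
  assumes "deg_wrt R D < 0"
  shows "D \<in> sigma_region \<Lambda>"
  unfolding sigma_iff
proof (intro allI notI)
  fix f assume "0 \<le> D + Q *v f"
  from deg_wrt_mono[OF R_pos this] assms show False
    by (simp add: deg_wrt_add deg_laplacian) (simp add: deg_wrt_def)
qed

text \<open>A maximum principle for the ratio \<open>f / R\<close>: where it is maximal, so it is at
  all neighbours, and connectivity makes it constant. Cross-multiplication keeps the statement in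
  the integers.\<close>

lemma kernel_laplacian:
  assumes "Q *v f = 0"
  shows "f $ i * R $ j = f $ j * R $ i"
proof -
  define h where "h i = real_of_int (f $ i) / real_of_int (R $ i)" for i
  have Rr: "real_of_int (R $ i) > 0" for i using R_pos by simp
  have fh: "real_of_int (f $ i) = h i * R $ i" for i
    using Rr[of i] by (simp add: h_def)
  have "\<exists>m. \<forall>j. h j \<le> h m"
  proof -
    have "Max (range h) \<in> range h" by (rule Max_in) auto
    then obtain m where "Max (range h) = h m" by (rule rangeE)
    then show ?thesis by (metis Max_ge finite_class.finite_UNIV finite_imageI rangeI)
  qed
  then obtain m where m: "\<And>j. h j \<le> h m" by blast
  have nbr: "h y = h m" if "h x = h m" "{x, y} \<in># G" for x y
  proof -
    \<comment> \<open>\<open>Q\<close> annihilates \<open>h x * R - f\<close>. In row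
      \<open>x\<close> the diagonal term vanishes and the others share one sign, so all of them
      vanish.\<close>
    have "(\<Sum>j\<in>UNIV. Q $ x $ j * (h x * R $ j - f $ j)) =
        h x * real_of_int ((Q *v R) $ x) - real_of_int ((Q *v f) $ x)"
      by (simp add: matrix_vector_mult_def sum_distrib_left sum_subtractf algebra_simps)
    then have "(\<Sum>j\<in>UNIV. - (Q $ x $ j * (h x * R $ j - f $ j))) = 0"
      by (simp add: sum_negf laplacian_R assms)
    moreover have "0 \<le> - (Q $ x $ j * (h x * R $ j - f $ j))" for j
    proof (cases "j = x")
      case False
      have "0 \<le> (h m - h j) * R $ j" using m[of j] Rr[of j] by simp
      then have "0 \<le> h x * R $ j - f $ j" by (simp add: fh that algebra_simps)
      then show ?thesis using False by (simp add: laplacian_component)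
    qed (simp add: fh)
    ultimately have "- (Q $ x $ y * (h x * R $ y - f $ y)) = 0"
      by (simp add: sum_nonneg_eq_0_iff)
    moreover have "x \<noteq> y" using that(2) count_singleton[of x] by (auto simp: count_eq_zero_iff)
    then have "Q $ x $ y \<noteq> 0"
      using that(2) by (simp add: laplacian_component count_eq_zero_iff)
    ultimately have "h x * R $ y = h y * R $ y" by (simp add: fh)
    then show ?thesis using Rr[of y] that by simp
  qed
  have const: "h x = h m" for x
  proof -
    have "(m, x) \<in> {(x, y). {x, y} \<in># G}\<^sup>*"
      using arith unfolding arithmetical_graph_def connected_multigraph_def by blast
    then show ?thesis
    proof (induction rule: rtrancl_induct)
      case (step y z)
      then show ?case using nbr[of y z] by simp
    qed simp
  qed
  have "real_of_int (f $ i * R $ j) = real_of_int (f $ j * R $ i)"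
    by (simp add: fh const[of i] const[of j])
  then show ?thesis by (simp only: of_int_eq_iff)
qed

section \<open>Borrowing sequences and their periods\<close>

text \<open>A borrow at a negative entry \<open>u\<close> is forced: if \<open>f \<ge> 0\<close>
  makes \<open>X\<close> effective, then \<open>f $ u > 0\<close>, because the other vertices can
  only lower entry \<open>u\<close>. Performing this borrow shortens \<open>f\<close> by one and
  stays in \<open>C\<close>, so induction on the total of \<open>f\<close> ends at an effective
  member of \<open>C\<close>, which is impossible.\<close>

lemma sigma_if_borrowing_closed:
  assumes closed: "\<And>X. X \<in> C \<Longrightarrow> \<exists>u. X $ u < 0 \<and> X + Q *v axis u 1 \<in> C"
    and "X \<in> C"
  shows "X \<in> sigma_region \<Lambda>"
proof -
  have no_nonneg: "\<not> 0 \<le> X + Q *v f"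
    if "X \<in> C" "\<And>i. 0 \<le> f $ i" "(\<Sum>i\<in>UNIV. f $ i) = int n" for X f n
    using that
  proof (induction n arbitrary: X f)
    case 0
    then have "f = 0" by (simp add: sum_nonneg_eq_0_iff vec_eq_iff)
    then show ?case using closed[OF 0(1)] by (auto simp: less_eq_vec_def not_le)
  next
    case (Suc n)
    obtain u where u: "X $ u < 0" "X + Q *v axis u 1 \<in> C" using closed Suc.prems(1) by blast
    show ?case
    proof
      assume le: "0 \<le> X + Q *v f"
      have "f $ u \<noteq> 0"
      proof
        assume "f $ u = 0"
        then have "Q $ u $ j * f $ j \<le> 0" for j
          using Suc.prems(2)[of j]
          by (cases "j = u") (simp_all add: laplacian_component mult_nonneg_nonneg)
        then have "(Q *v f) $ u \<le> 0"
          by (simp add: matrix_vector_mult_def sum_nonpos)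
        with u(1) have "(X + Q *v f) $ u < 0" by simp
        with le show False by (simp add: less_eq_vec_def not_le[symmetric])
      qed
      let ?f = "f - axis u 1"
      have "0 \<le> ?f $ i" for i
        using \<open>f $ u \<noteq> 0\<close> Suc.prems(2)[of i] by (auto simp: axis_def)
      moreover have "(\<Sum>i\<in>UNIV. ?f $ i) = int n"
        using Suc.prems(3) by (simp add: sum_subtractf axis_def)
      ultimately have "\<not> 0 \<le> X + Q *v axis u 1 + Q *v ?f"
        using Suc.IH u(2) by blast
      with le show False
        by (simp add: matrix_vector_mult_diff_distrib)
    qed
  qed
  show ?thesis
    unfolding sigma_iff
  proof (intro allI notI)
    fix f assume le: "0 \<le> X + Q *v f"
    \<comment> \<open>A kernel multiple of \<open>R\<close> makes \<open>f\<close> nonnegative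
      without changing \<open>Q *v f\<close>; \<open>M\<close> is large enough because
      \<open>R $ i \<ge> 1\<close>.\<close>
    define M where "M = (\<Sum>i\<in>UNIV. \<bar>f $ i\<bar>)"
    let ?f = "f + M *s R"
    have "0 \<le> ?f $ i" for i
    proof -
      have "\<bar>f $ i\<bar> \<le> M" unfolding M_def by (rule member_le_sum) auto
      moreover have "M * 1 \<le> M * R $ i"
        using R_pos by (intro mult_left_mono) (auto simp: M_def sum_nonneg int_one_le_iff_zero_less)
      ultimately show ?thesis by simp
    qed
    moreover from this have "0 \<le> (\<Sum>i\<in>UNIV. ?f $ i)" by (intro sum_nonneg) blast
    then obtain n where "(\<Sum>i\<in>UNIV. ?f $ i) = int n" by (metis nonneg_int_cases)
    ultimately have "\<not> 0 \<le> X + Q *v ?f" using no_nonneg \<open>X \<in> C\<close> by blast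
    moreover have "Q *v (M *s R) = M *s (Q *v R)"
      by (simp add: vec_eq_iff matrix_vector_mult_def sum_distrib_left mult_ac)
    then have "Q *v ?f = Q *v f"
      by (simp add: matrix_vector_right_distrib laplacian_R)
    ultimately show False using le by simp
  qed
qed

text \<open>
  A divisor in \<open>\<Sigma>\<close> and its translates always have a negative entry, so one can borrow forever.
\<close>

lemma borrowing_sequence:
  assumes "D \<in> sigma_region \<Lambda>"
  obtains c u where "c 0 = 0" "\<And>k. c (Suc k) = c k + axis (u k) 1"
    "\<And>k. (D + Q *v c k) $ u k < 0"
proof -
  have "\<exists>u. (D + Q *v f) $ u < 0" for f
    using assms unfolding sigma_iff by (auto simp: less_eq_vec_def not_le)
  then obtain w where w: "\<And>f. (D + Q *v f) $ w f < 0" by metis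
  define c where "c = rec_nat 0 (\<lambda>_ f. f + axis (w f) 1)"
  have "c 0 = 0" "\<And>k. c (Suc k) = c k + axis (w (c k)) 1" by (simp_all add: c_def)
  with w that[of c "\<lambda>k. w (c k)"] show thesis by blast
qed

text \<open>A vertex gains only while negative, and then by \<delta>, so entries are bounded above.
  The constant degree bounds them below as well, and some divisor in the resulting finite box must
  recur.\<close>

lemma borrowing_periodic:
  assumes c: "c 0 = 0" "\<And>k. c (Suc k) = c k + axis (u k) 1"
    and neg: "\<And>k. (D + Q *v c k) $ u k < 0"
  obtains a b where "a < b" "D + Q *v c a = D + Q *v c b"
proof -
  define M where "M i = \<bar>D $ i\<bar> + \<bar>\<delta> $ i\<bar>" for i
  have upper: "(D + Q *v c k) $ i \<le> M i" for k i
  proof (induction k)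
    case (Suc k)
    have eq: "(D + Q *v c (Suc k)) $ i = (D + Q *v c k) $ i + Q $ i $ u k"
      by (simp add: c(2) matrix_vector_right_distrib laplacian_axis)
    show ?case
    proof (cases "i = u k")
      case True
      then show ?thesis unfolding eq using neg[of k] by (simp add: laplacian_component M_def)
    next
      case False
      then show ?thesis unfolding eq using Suc by (simp add: laplacian_component)
    qed
  qed (simp add: c(1) M_def)
  \<comment> \<open>If all other entries are at their upper bounds, the fixed degree still leaves at
    least \<open>- N\<close> for the weighted entry at \<open>i\<close>.\<close>
  define N where "N = \<bar>deg_wrt R D\<bar> + (\<Sum>i\<in>UNIV. M i * R $ i)"
  have lower: "- N \<le> (D + Q *v c k) $ i" for k i
  proof -
    let ?X = "D + Q *v c k"
    have RR: "1 \<le> R $ j" "0 \<le> R $ j" for j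
      using R_pos by (simp_all add: int_one_le_iff_zero_less less_imp_le)
    have M0: "0 \<le> M j" for j by (simp add: M_def)
    have "deg_wrt R D = deg_wrt R ?X" by (simp add: deg_wrt_add deg_laplacian)
    also have "\<dots> = ?X $ i * R $ i + (\<Sum>j\<in>UNIV-{i}. ?X $ j * R $ j)"
      unfolding deg_wrt_def by (simp add: sum.remove)
    also have "(\<Sum>j\<in>UNIV-{i}. ?X $ j * R $ j) \<le> (\<Sum>j\<in>UNIV-{i}. M j * R $ j)"
      by (intro sum_mono mult_right_mono upper RR)
    also have "\<dots> \<le> (\<Sum>j\<in>UNIV. M j * R $ j)"
      by (intro sum_mono2) (auto intro!: mult_nonneg_nonneg simp: M0 RR)
    finally have "- N \<le> ?X $ i * R $ i" by (simp add: N_def)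
    moreover have "0 \<le> N" unfolding N_def by (intro add_nonneg_nonneg sum_nonneg mult_nonneg_nonneg M0 RR abs_ge_zero)
    moreover have "?X $ i * R $ i \<le> ?X $ i" if "?X $ i < 0"
      using mult_left_mono_neg[of 1 "R $ i" "?X $ i"] that RR[of i] by simp
    ultimately show ?thesis by linarith
  qed
  have "range (\<lambda>k. D + Q *v c k) \<subseteq> {x. \<forall>i. - N \<le> x $ i \<and> x $ i \<le> M i}"
    using upper lower by blast
  then have "finite (range (\<lambda>k. D + Q *v c k))"
    using finite_vec_interval by (rule finite_subset)
  then have "\<not> inj (\<lambda>k. D + Q *v c k)"
    using finite_imageD infinite_UNIV_nat by blast
  then obtain x y where "x \<noteq> y" "D + Q *v c x = D + Q *v c y" by (auto simp: inj_def)
  then show thesis using that[of x y] that[of y x] by (cases "x < y") auto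
qed

text \<open>
  Along a borrowing sequence \<open>D\<^sub>k = D + Q c\<^sub>k\<close> the quantity \<open>c\<^sub>k \<cdot> (D + D\<^sub>k)\<close> grows by
  \<open>2 D\<^sub>k(u) + \<delta>(u) \<le> K\<^sub>0(u)\<close> when \<open>u\<close> borrows. Over a period \<open>c\<close> grows by a multiple of \<open>R\<close>, which
  yields \<open>2 deg D \<le> deg K\<^sub>0\<close>; in the case of equality every borrowing vertex has value exactly \<open>-1\<close>,
  and the period read backwards is a borrowing sequence of \<open>K\<^sub>0 - D\<close>.
\<close>

lemma sigma_deg_bound_and_reflection:
  assumes "D \<in> sigma_region \<Lambda>"
  shows "2 * deg_wrt R D \<le> deg_wrt R K\<^sub>0"
    and "2 * deg_wrt R D = deg_wrt R K\<^sub>0 \<Longrightarrow> K\<^sub>0 - D \<in> sigma_region \<Lambda>"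
proof -
  obtain c u where c: "c 0 = 0" "\<And>k. c (Suc k) = c k + axis (u k) 1"
    and neg: "\<And>k. (D + Q *v c k) $ u k < 0"
    using borrowing_sequence[OF assms] by blast
  obtain a b where ab: "a < b" "D + Q *v c a = D + Q *v c b"
    using borrowing_periodic[OF c neg] by blast
  define X where "X k = D + Q *v c k" for k
  have X_Suc: "X (Suc k) = X k + Q *v axis (u k) 1" for k
    by (simp add: X_def c(2) matrix_vector_right_distrib add.assoc)
  \<comment> \<open>Subtracting the pairing with \<open>K\<^sub>0\<close> makes \<open>F\<close>
    nonincreasing; it is stationary exactly when the borrower has value -1.\<close>
  define F where "F k = deg_wrt (c k) (D + X k) - deg_wrt (c k) K\<^sub>0" for k
  have F_Suc: "F (Suc k) = F k + 2 * (X k $ u k + 1)" for k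
  proof -
    have "deg_wrt (c k) (Q *v axis (u k) 1) = (Q *v c k) $ u k"
      by (subst laplacian_self_adjoint) (metis deg_wrt_axis deg_wrt_commute)
    then have "F (Suc k) = F k + (D + X (Suc k)) $ u k - K\<^sub>0 $ u k + (Q *v c k) $ u k"
      unfolding F_def c(2) X_Suc
      by (simp add: deg_wrt_add_left deg_wrt_add deg_wrt_diff deg_wrt_commute[of "axis _ _"] deg_wrt_axis)
    also have "(D + X (Suc k)) $ u k = D $ u k + X k $ u k + \<delta> $ u k"
      by (simp add: X_Suc laplacian_axis laplacian_component)
    also have "(Q *v c k) $ u k = X k $ u k - D $ u k" by (simp add: X_def)
    finally show ?thesis by simp
  qed
  have F_dec: "F (Suc k) \<le> F k" for k
    using neg[of k] unfolding F_Suc by (simp add: X_def)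
  have F_anti: "F l \<le> F k" if "k \<le> l" for k l
    using F_dec that by (rule lift_Suc_antimono_le)
  define p where "p = c b - c a"
  have "Q *v p = 0" using ab(2) by (simp add: p_def matrix_vector_mult_diff_distrib)
  note ker = kernel_laplacian[OF this]
  have c_mono: "c k $ i \<le> c l $ i" if "k \<le> l" for k l i
    using _ that by (rule lift_Suc_mono_le[of "\<lambda>k. c k $ i"]) (simp add: c(2) axis_def)
  \<comment> \<open>This vertex borrows during the period, so the multiple of \<open>R\<close> that
    \<open>p\<close> represents is positive.\<close>
  let ?v = "u a"
  have "c a $ ?v < c (Suc a) $ ?v" by (simp add: c(2))
  also have "\<dots> \<le> c b $ ?v" using ab(1) by (intro c_mono) simp
  finally have p_pos: "0 < p $ ?v" by (simp add: p_def)
  have deg_p: "R $ ?v * deg_wrt p y = p $ ?v * deg_wrt R y" for y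
    unfolding deg_wrt_def sum_distrib_left
    by (intro sum.cong refl) (metis ker mult.assoc mult.commute)
  have "F b - F a = deg_wrt p (D + X a) - deg_wrt p K\<^sub>0"
  proof -
    have "X b = X a" using ab(2) by (simp add: X_def)
    then show ?thesis
      by (simp add: F_def p_def deg_wrt_diff_left)
  qed
  moreover have "deg_wrt R (D + X a) = 2 * deg_wrt R D"
    unfolding X_def deg_wrt_add deg_laplacian by simp
  ultimately have F_ab: "R $ ?v * (F b - F a) = p $ ?v * (2 * deg_wrt R D - deg_wrt R K\<^sub>0)"
    by (simp add: deg_p right_diff_distrib)
  have Rv: "0 < R $ ?v" using R_pos by blast
  have "R $ ?v * (F b - F a) \<le> 0"
    using Rv F_anti[of a b] ab(1) by (intro mult_nonneg_nonpos) auto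
  then show bound: "2 * deg_wrt R D \<le> deg_wrt R K\<^sub>0"
    using p_pos unfolding F_ab by (simp add: mult_le_0_iff)
  assume eq: "2 * deg_wrt R D = deg_wrt R K\<^sub>0"
  then have Fab: "F b = F a" using F_ab Rv by simp
  have X_u: "X k $ u k = -1" if "a \<le> k" "k < b" for k
  proof -
    have "F b \<le> F (Suc k)" "F (Suc k) \<le> F k" "F k \<le> F a"
      using that F_anti F_dec by auto
    then show ?thesis using Fab F_Suc[of k] by simp
  qed
  have "K\<^sub>0 - X b \<in> sigma_region \<Lambda>"
  \<comment> \<open>The period read backwards: undoing a borrow from -1 is again a borrow from -1
    for the reflected divisor, and \<open>X a = X b\<close> closes the cycle.\<close>
  proof (rule sigma_if_borrowing_closed[of "{K\<^sub>0 - X k |k. a < k \<and> k \<le> b}"])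
    fix Y assume "Y \<in> {K\<^sub>0 - X k |k. a < k \<and> k \<le> b}"
    then obtain k where k: "Y = K\<^sub>0 - X (Suc k)" "a \<le> k" "k < b"
      by (smt (verit) Suc_le_eq less_Suc_eq_le mem_Collect_eq not_less_zero old.nat.exhaust)
    have "Y $ u k = -1"
      using X_u[OF k(2,3)] by (simp add: k(1) X_Suc laplacian_axis laplacian_component)
    moreover have "Y + Q *v axis (u k) 1 = K\<^sub>0 - X k" by (simp add: k(1) X_Suc)
    moreover have "\<exists>l. K\<^sub>0 - X k = K\<^sub>0 - X l \<and> a < l \<and> l \<le> b"
    proof (cases "k = a")
      case True
      then show ?thesis using ab by (intro exI[of _ b]) (simp add: X_def)
    next
      case False
      then show ?thesis using k by (intro exI[of _ k]) simp
    qed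
    ultimately show "\<exists>v. Y $ v < 0 \<and> Y + Q *v axis v 1 \<in> {K\<^sub>0 - X k |k. a < k \<and> k \<le> b}"
      by (intro exI[of _ "u k"]) auto
  qed (use ab in auto)
  then have "K\<^sub>0 - X b + Q *v c b \<in> sigma_region \<Lambda>" by (simp only: sigma_translate)
  moreover have "K\<^sub>0 - X b + Q *v c b = K\<^sub>0 - D" by (simp add: X_def)
  ultimately show "K\<^sub>0 - D \<in> sigma_region \<Lambda>" by metis
qed

section \<open>Degrees of extreme points\<close>

text \<open>Below this bound, raising entry \<open>i\<close> by one would leave the degree negative
  and hence stay in \<Sigma>. The bound guarantees that the minimum in \<open>g_min\<close>
  exists.\<close>

lemma ext_points_deg_ge_neg:
  assumes "\<nu> \<in> ext_points R \<Lambda>"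
  shows "- (R $ i) \<le> deg_wrt R \<nu>"
proof (rule ccontr)
  assume "\<not> - (R $ i) \<le> deg_wrt R \<nu>"
  then have "\<nu> + axis i 1 \<in> sigma_region \<Lambda>"
    by (intro sigma_if_deg_neg) (simp add: deg_wrt_add deg_wrt_axis)
  then have "\<nu> + axis i 1 = \<nu>"
    by (rule ext_points_maximal[OF R_pos assms]) (simp add: less_eq_vec_def axis_def)
  then show False by (auto simp: vec_eq_iff axis_def split: if_splits)
qed

text \<open>The degree is squeezed between the minimum defining \<open>g_min\<close> and half the
  degree of \<open>K\<^sub>0\<close>, and both equal \<open>g - 1\<close>.\<close>

lemma ext_points_deg_eq:
  assumes "deg_wrt R K\<^sub>0 = 2 * g - 2" "g = g_min R \<Lambda>" "\<nu> \<in> ext_points R \<Lambda>"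
  shows "deg_wrt R \<nu> = g - 1"
proof -
  have "(LEAST d. d \<in> deg_wrt R ` ext_points R \<Lambda>) \<le> deg_wrt R \<nu>"
    using ext_points_deg_ge_neg assms(3)
    \<comment> \<open>Here \<open>undefined\<close> is just an arbitrary vertex; any of them gives a
      lower bound.\<close>
    by (intro Least_int_bounded_below(2)[of _ _ "- (R $ undefined)"]) auto
  moreover have "2 * deg_wrt R \<nu> \<le> deg_wrt R K\<^sub>0"
    using assms(3) sigma_deg_bound_and_reflection(1) by (simp add: ext_points_def)
  ultimately show ?thesis using assms(1,2) by (simp add: g_min_def)
qed

lemma sigma_nonempty: "sigma_region \<Lambda> \<noteq> {}"
proof -
  have "0 < (\<Sum>i\<in>UNIV. R $ i)" using R_pos by (intro sum_pos) auto
  then have "deg_wrt R (- 1) < 0" by (simp add: deg_wrt_def sum_negf)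
  then show ?thesis using sigma_if_deg_neg by blast
qed

lemma arith_lattice_uminus: "p \<in> \<Lambda> \<Longrightarrow> - p \<in> \<Lambda>"
  unfolding arith_lattice_eq
  by (auto simp: image_iff) (metis add.inverse_inverse diff_0 matrix_vector_mult_0_right matrix_vector_mult_diff_distrib)

end

section \<open>The corresponding directed graph\<close>

lemma out_deg_eq_sum:
  fixes H :: "'v::finite dimultigraph"
  shows "out_deg H v = (\<Sum>j\<in>UNIV. int (count H (v, j)))"
proof (induction H)
  case (add a H)
  have "out_deg (add_mset a H) v = (if fst a = v then 1 else 0) + out_deg H v"
    by (simp add: out_deg_def)
  moreover have "(\<Sum>j\<in>UNIV. int (count (add_mset a H) (v, j)))
      = (\<Sum>j\<in>UNIV. (if j = snd a then (if fst a = v then 1 else 0) else 0) + int (count H (v, j)))"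
    by (intro sum.cong) auto
  ultimately show ?case using add by (simp add: sum.distrib)
qed (simp add: out_deg_def)

context arith_graph
begin

lemma count_directed_graph:
  "count (directed_graph G R) (i, j) = count G {i, j} * nat (R $ j)"
proof -
  have "count (\<Sum>(x, y)\<in>{(x, y). {x, y} = e}. replicate_mset (nat (R $ y)) (x, y)) (i, j)
      = (if e = {i, j} then nat (R $ j) else 0)" for e
  proof -
    have "count (\<Sum>(x, y)\<in>{(x, y). {x, y} = e}. replicate_mset (nat (R $ y)) (x, y)) (i, j)
      = (\<Sum>a\<in>{(x, y). {x, y} = e}. if a = (i, j) then nat (R $ j) else 0)"
      unfolding count_sum by (intro sum.cong refl) (auto split: prod.splits)
    also have "\<dots> = (if e = {i, j} then nat (R $ j) else 0)"
      by (subst sum.delta) auto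
    finally show ?thesis .
  qed
  then have "count (directed_graph G R) (i, j) = (\<Sum>e\<in>#G. if e = {i, j} then nat (R $ j) else 0)"
    unfolding directed_graph_def by (induction G) auto
  then show ?thesis by (simp add: sum_mset_delta)
qed

text \<open>Row \<open>i\<close> of \<open>Q *v R = 0\<close> balances the diagonal term against the
  weighted number of neighbours, which is the out-degree.\<close>

lemma out_deg_directed_graph: "out_deg (directed_graph G R) i = \<delta> $ i * R $ i"
proof -
  have "0 = (Q *v R) $ i" by (simp add: laplacian_R)
  also have "\<dots> = \<delta> $ i * R $ i - (\<Sum>j\<in>UNIV-{i}. int (count G {i, j}) * R $ j)"
    unfolding matrix_vector_mult_def
    by (simp add: sum.remove[of UNIV i] laplacian_component sum_negf cong: sum.cong_simp)
  also have "(\<Sum>j\<in>UNIV-{i}. int (count G {i, j}) * R $ j) = (\<Sum>j\<in>UNIV. int (count G {i, j}) * R $ j)"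
    by (simp add: sum.remove[of UNIV i "\<lambda>j. int (count G {i, j}) * R $ j"] count_singleton)
  also have "\<dots> = out_deg (directed_graph G R) i"
    unfolding out_deg_eq_sum count_directed_graph using R_pos by (simp add: less_imp_le)
  finally show ?thesis by simp
qed

abbreviation "\<Lambda>\<^sub>d \<equiv> lattice_spanned (\<lambda>i. row i (di_laplacian (directed_graph G R)))"

text \<open>Row \<open>i\<close> of the directed Laplacian is column \<open>i\<close> of
  \<open>Q\<close> scaled componentwise by \<open>R\<close>.\<close>

lemma directed_lattice_eq: "\<Lambda>\<^sub>d = (*) R ` \<Lambda>"
proof -
  have entry: "di_laplacian (directed_graph G R) $ i $ j = R $ j * Q $ j $ i" for i j
    using R_pos
    by (auto simp: di_laplacian_def diag_matrix_def di_adj_matrix_def out_deg_directed_graph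
        count_directed_graph laplacian_component count_singleton insert_commute less_imp_le)
  have "(\<Sum>k\<in>UNIV. c k *s row k (di_laplacian (directed_graph G R)))
      = R * (\<Sum>k\<in>UNIV. c k *s column k Q)" for c
    by (simp add: vec_eq_iff row_def column_def entry sum_distrib_left mult_ac)
  then show ?thesis
    by (simp add: lattice_spanned_def arith_lattice_def image_image)
qed

section \<open>Rounding between the two lattices\<close>

definition floor_div :: "int ^ 'v \<Rightarrow> int ^ 'v" where
  "floor_div D = (\<chi> i. D $ i div R $ i)"

text \<open>The largest divisor whose componentwise quotient by \<open>R\<close> is
  \<open>D\<close>: each remainder is \<open>R $ i - 1\<close>.\<close>

definition lift_div :: "int ^ 'v \<Rightarrow> int ^ 'v" where
  "lift_div D = R * D + R - 1"

text \<open>Scaling by \<open>R\<close> and rounded division form a Galois connection: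
  \<open>R * p \<le> D\<close> iff \<open>p \<le> floor_div D\<close>.\<close>

lemma directed_sigma_iff: "D \<in> sigma_region \<Lambda>\<^sub>d \<longleftrightarrow> floor_div D \<in> sigma_region \<Lambda>"
proof -
  have "p * r \<le> d \<longleftrightarrow> p \<le> d div r" if "r > 0" for p d r :: int
  proof
    assume "p * r \<le> d"
    from zdiv_mono1[OF this that] show "p \<le> d div r" using that by simp
  next
    assume "p \<le> d div r"
    then have "p * r \<le> d div r * r" using that by (intro mult_right_mono) auto
    also have "\<dots> \<le> d" using that pos_mod_sign[of r d] div_mult_mod_eq[of d r] by linarith
    finally show "p * r \<le> d" .
  qed
  then have "R * p \<le> D \<longleftrightarrow> p \<le> floor_div D" for p
    using R_pos by (simp add: less_eq_vec_def floor_div_def mult.commute)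
  then show ?thesis by (simp add: sigma_region_def directed_lattice_eq)
qed

lemma floor_lift: "floor_div (lift_div \<nu>) = \<nu>"
proof -
  have "(r * x + r - 1) div r = x" if "r > 0" for r x :: int
  proof -
    have "(r * x + r - 1) div r = (r - 1 + r * x) div r" by (simp add: algebra_simps)
    also have "\<dots> = x + (r - 1) div r" using that by (intro div_mult_self2) simp
    finally show ?thesis using that by simp
  qed
  then show ?thesis using R_pos by (simp add: vec_eq_iff floor_div_def lift_div_def)
qed

lemma le_lift_floor:
  assumes "floor_div D \<le> \<nu>"
  shows "D \<le> lift_div \<nu>"
  unfolding less_eq_vec_def
proof
  fix i
  have r: "0 < R $ i" using R_pos by blast
  have "D $ i div R $ i \<le> \<nu> $ i" using assms by (simp add: less_eq_vec_def floor_div_def)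
  then have "R $ i * (D $ i div R $ i) \<le> R $ i * \<nu> $ i" using r by (intro mult_left_mono) auto
  moreover have "D $ i = R $ i * (D $ i div R $ i) + D $ i mod R $ i" by simp
  moreover have "D $ i mod R $ i < R $ i" using r by simp
  ultimately have "D $ i \<le> R $ i * \<nu> $ i + R $ i - 1" by linarith
  then show "D $ i \<le> lift_div \<nu> $ i" by (simp add: lift_div_def)
qed

lemma deg_lift: "deg_wrt (vec 1) (lift_div D) = deg_wrt R D + (\<Sum>i\<in>UNIV. R $ i - 1)"
  by (simp add: deg_wrt_def lift_div_def sum.distrib sum_subtractf algebra_simps)

end

section \<open>Riemann-Roch for both lattices\<close>

theorem theorem4p6:
  fixes G :: "'v::finite multigraph" and R \<delta> :: "int ^ 'v" and g0 :: int
  assumes "arithmetical_graph G R \<delta>"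
    and "2 * g0 - 2 = (\<Sum>i\<in>UNIV. R $ i * (\<delta> $ i - 2))"
    and "g0 = g_min R (arith_lattice G \<delta>)"
    and "g_min R (arith_lattice G \<delta>) = g_max R (arith_lattice G \<delta>)"
  shows "riemann_roch_property R (arith_lattice G \<delta>) \<and>
         natural_riemann_roch (directed_graph G R)"
proof -
  interpret arith_graph G R \<delta> using assms(1) by unfold_locales
  have degK: "deg_wrt R K\<^sub>0 = 2 * g0 - 2"
    unfolding assms(2) by (simp add: deg_wrt_def mult.commute)
  have bound: "deg_wrt R D \<le> g0 - 1" if "D \<in> sigma_region \<Lambda>" for D
    using sigma_deg_bound_and_reflection(1)[OF that] degK by simp
  have uniform: "deg_wrt R \<nu> = g0 - 1" if "\<nu> \<in> ext_points R \<Lambda>" for \<nu>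
    using ext_points_deg_eq[OF degK assms(3) that] .
  have reflect: "K\<^sub>0 - \<nu> \<in> sigma_region \<Lambda>" if "\<nu> \<in> ext_points R \<Lambda>" for \<nu>
    using that uniform[OF that] degK
    by (intro sigma_deg_bound_and_reflection(2)) (simp_all add: ext_points_def)
  have "riemann_roch_with R \<Lambda> K\<^sub>0"
    by (rule riemann_roch_if_reflection[OF R_pos arith_lattice_uminus sigma_nonempty bound uniform reflect degK])
  moreover have "riemann_roch_with (vec 1) \<Lambda>\<^sub>d (\<chi> i. out_deg (directed_graph G R) i - 2)"
  proof -
    let ?K = "\<chi> i. out_deg (directed_graph G R) i - 2"
    let ?s = "\<Sum>i\<in>UNIV. R $ i - 1"
    have one: "\<forall>i::'v. (vec 1 :: int ^ 'v) $ i > 0" by simp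
    have lift_sigma: "lift_div \<nu> \<in> sigma_region \<Lambda>\<^sub>d" if "\<nu> \<in> sigma_region \<Lambda>" for \<nu>
      using that by (simp add: directed_sigma_iff floor_lift)
    \<comment> \<open>\<open>D\<close> lies below the lift of an extreme point above its quotient,
      and maximality of \<open>D\<close> forces equality.\<close>
    have ext: "\<exists>\<nu>\<in>ext_points R \<Lambda>. D = lift_div \<nu>" if D: "D \<in> ext_points (vec 1) \<Lambda>\<^sub>d" for D
    proof -
      have "floor_div D \<in> sigma_region \<Lambda>"
        using D by (simp add: ext_points_def directed_sigma_iff)
      then obtain \<nu> where \<nu>: "\<nu> \<in> ext_points R \<Lambda>" "floor_div D \<le> \<nu>"
        using ext_point_above[OF R_pos bound] by blast
      then have "lift_div \<nu> \<in> sigma_region \<Lambda>\<^sub>d"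
        by (simp add: ext_points_def lift_sigma)
      then have "lift_div \<nu> = D"
        using ext_points_maximal[OF one D] le_lift_floor[OF \<nu>(2)] by blast
      with \<nu> show ?thesis by blast
    qed
    show ?thesis
    \<comment> \<open>Lifting raises degrees by \<open>?s\<close>, so the genus shifts by
      \<open>?s\<close>.\<close>
    proof (rule riemann_roch_if_reflection[OF one, where B = "g0 + ?s - 1" and g = "g0 + ?s"])
      show "- p \<in> \<Lambda>\<^sub>d" if "p \<in> \<Lambda>\<^sub>d" for p
        using that arith_lattice_uminus unfolding directed_lattice_eq
        by (auto simp: image_iff) (metis mult_minus_right)
      show "sigma_region \<Lambda>\<^sub>d \<noteq> {}" using sigma_nonempty lift_sigma by blast
      show "deg_wrt (vec 1) D \<le> g0 + ?s - 1" if "D \<in> sigma_region \<Lambda>\<^sub>d" for D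
      proof -
        have "deg_wrt (vec 1) D \<le> deg_wrt (vec 1) (lift_div (floor_div D))"
          by (rule deg_wrt_mono[OF one le_lift_floor]) simp
        also have "\<dots> \<le> g0 + ?s - 1"
          unfolding deg_lift using that bound[of "floor_div D"] by (simp add: directed_sigma_iff)
        finally show ?thesis .
      qed
      show "deg_wrt (vec 1) D = g0 + ?s - 1" if "D \<in> ext_points (vec 1) \<Lambda>\<^sub>d" for D
        using ext[OF that] uniform deg_lift by fastforce
      show "?K - D \<in> sigma_region \<Lambda>\<^sub>d" if D: "D \<in> ext_points (vec 1) \<Lambda>\<^sub>d" for D
      proof -
        obtain \<nu> where \<nu>: "\<nu> \<in> ext_points R \<Lambda>" "D = lift_div \<nu>" using ext[OF D] by blast
        \<comment> \<open>The lift intertwines the two reflections: both sides equal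
          \<open>R * \<delta> - R * \<nu> - R - 1\<close>.\<close>
        have "?K - D = lift_div (K\<^sub>0 - \<nu>)"
          unfolding \<nu>(2) lift_div_def by (simp add: vec_eq_iff out_deg_directed_graph algebra_simps)
        then show ?thesis using lift_sigma reflect[OF \<nu>(1)] by simp
      qed
      show "deg_wrt (vec 1) ?K = 2 * (g0 + ?s) - 2"
      proof -
        have "deg_wrt (vec 1) ?K = deg_wrt R K\<^sub>0 + 2 * ?s"
          by (simp add: deg_wrt_def out_deg_directed_graph sum.distrib[symmetric] sum_distrib_left
              algebra_simps sum_subtractf)
        then show ?thesis by (simp add: degK)
      qed
    qed
  qed
  ultimately show ?thesis
    unfolding riemann_roch_property_def natural_riemann_roch_def by blast
qed

end
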